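(* Let $0<M_1<M_2$ and $R_2>R_1>2M_2$. For every $u\in\mathcal A_{BV}$, with $\mu=(Du)^+$, $\nu=(Du)^-$ and $\delta[u]:=\mathcal J[u]-\lambda_*$, $$\delta[u]=\int(W_u-q)\,d\mu+\int g\,d\mu+\lambda_*\int A\,d\nu .$$ All three terms on the right-hand side are nonnegative.
   Context: $\Delta M:=M_2-M_1$. $\mathcal A_{BV}$: functions $u\in BV(\mathbb R)$ (so $u\in L^1(\mathbb R)$ and $Du$ is a finite signed Radon measure on $\mathbb R$) with $u\ge0$ a.e., $u=0$ a.e. on $\mathbb R\setminus[R_1,R_2]$, $\int_{R_1}^{R_2}r^2u\,dr=1$. $Du=(Du)^+-(Du)^-$ is the Jordan decomposition (both measures are carried by $[R_1,R_2]$). $P_u(r)=\int_{R_1}^r s^2u(s)\,ds$, $F_u(r)=1-\frac{2(M_1+\Delta M\,P_u(r))}{r}$, $W_u(r)=\frac{r^3}{\sqrt{F_u(r)}}$ on $[R_1,R_2]$; $\mathcal J[u]=\int_{[R_1,R_2]}W_u\,d(Du)^+$. $A(r)=\frac{R_2^3-r^3}{3}$, $q(r)=\frac{r^{7/2}}{\sqrt{r-2M_1}}$, $\Psi=q/A$. $x_0$ is the unique real solution of $M_1x_0^3+3R_2^3x_0-7M_1R_2^3=0$. $a=\max\{R_1,x_0\}$, $\lambda_*=\Psi(a)$ (which is the minimum of $\Psi$ on $[R_1,R_2)$), and $g(r):=q(r)-\lambda_*A(r)$. *)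

theory Defs
  imports "HOL-Analysis.Analysis"
begin

section \<open>Functions of bounded variation on the real line\<close>

definition test_function :: "(real \<Rightarrow> real) \<Rightarrow> bool" where
  "test_function \<phi> \<longleftrightarrow>
     (\<forall>n x. (deriv ^^ n) \<phi> field_differentiable (at x)) \<and> compact (closure {x. \<phi> x \<noteq> 0})"

text \<open>
  A finite signed Radon measure on the line is represented by a pair of finite Borel measures
  \<open>\<mu>\<close>, \<open>\<nu>\<close>, standing for \<open>\<mu> - \<nu>\<close>. The predicate says that \<open>\<mu> - \<nu>\<close> is the distributional
  derivative of \<open>u\<close>.
\<close>

definition has_measure_derivative ::
    "(real \<Rightarrow> real) \<Rightarrow> real measure \<Rightarrow> real measure \<Rightarrow> bool" where
  "has_measure_derivative u \<mu> \<nu> \<longleftrightarrow>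
     finite_measure \<mu> \<and> sets \<mu> = sets borel \<and>
     finite_measure \<nu> \<and> sets \<nu> = sets borel \<and>
     (\<forall>\<phi>. test_function \<phi> \<longrightarrow>
        (LINT x|lebesgue. u x * deriv \<phi> x) = - ((LINT x|\<mu>. \<phi> x) - (LINT x|\<nu>. \<phi> x)))"

definition BV :: "(real \<Rightarrow> real) set" where
  "BV = {u. integrable lebesgue u \<and> (\<exists>\<mu> \<nu>. has_measure_derivative u \<mu> \<nu>)}"

definition mutually_singular :: "'a measure \<Rightarrow> 'a measure \<Rightarrow> bool" where
  "mutually_singular \<mu> \<nu> \<longleftrightarrow>
     (\<exists>N\<in>sets \<mu> \<inter> sets \<nu>. emeasure \<mu> N = 0 \<and> emeasure \<nu> (space \<nu> - N) = 0)"

text \<open>The Jordan decomposition is the unique representing pair that is mutually singular.\<close>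

definition jordan_derivative :: "(real \<Rightarrow> real) \<Rightarrow> real measure \<times> real measure" where
  "jordan_derivative u =
     (THE p. has_measure_derivative u (fst p) (snd p) \<and> mutually_singular (fst p) (snd p))"

definition D_pos :: "(real \<Rightarrow> real) \<Rightarrow> real measure" where
  "D_pos u = fst (jordan_derivative u)"

definition D_neg :: "(real \<Rightarrow> real) \<Rightarrow> real measure" where
  "D_neg u = snd (jordan_derivative u)"


section \<open>The variational problem\<close>

definition A_BV :: "real \<Rightarrow> real \<Rightarrow> (real \<Rightarrow> real) set" where
  "A_BV R1 R2 = {u \<in> BV.
     (AE r in lebesgue. 0 \<le> u r) \<and>
     (AE r in lebesgue. r \<notin> {R1..R2} \<longrightarrow> u r = 0) \<and>
     (LINT r:{R1..R2}|lebesgue. r\<^sup>2 * u r) = 1}"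

definition P :: "real \<Rightarrow> (real \<Rightarrow> real) \<Rightarrow> real \<Rightarrow> real" where
  "P R1 u r = (LINT s:{R1..r}|lebesgue. s\<^sup>2 * u s)"

definition F :: "real \<Rightarrow> real \<Rightarrow> real \<Rightarrow> (real \<Rightarrow> real) \<Rightarrow> real \<Rightarrow> real" where
  "F M1 M2 R1 u r = 1 - 2 * (M1 + (M2 - M1) * P R1 u r) / r"

definition W :: "real \<Rightarrow> real \<Rightarrow> real \<Rightarrow> (real \<Rightarrow> real) \<Rightarrow> real \<Rightarrow> real" where
  "W M1 M2 R1 u r = r ^ 3 / sqrt (F M1 M2 R1 u r)"

definition J :: "real \<Rightarrow> real \<Rightarrow> real \<Rightarrow> real \<Rightarrow> (real \<Rightarrow> real) \<Rightarrow> real" where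
  "J M1 M2 R1 R2 u = (LINT r:{R1..R2}|D_pos u. W M1 M2 R1 u r)"

definition A :: "real \<Rightarrow> real \<Rightarrow> real" where
  "A R2 r = (R2 ^ 3 - r ^ 3) / 3"

definition q :: "real \<Rightarrow> real \<Rightarrow> real" where
  "q M1 r = r powr (7 / 2) / sqrt (r - 2 * M1)"

definition Psi :: "real \<Rightarrow> real \<Rightarrow> real \<Rightarrow> real" where
  "Psi M1 R2 r = q M1 r / A R2 r"

definition x0 :: "real \<Rightarrow> real \<Rightarrow> real" where
  "x0 M1 R2 = (THE x. M1 * x ^ 3 + 3 * R2 ^ 3 * x - 7 * M1 * R2 ^ 3 = 0)"

definition lambda_star :: "real \<Rightarrow> real \<Rightarrow> real \<Rightarrow> real" where
  "lambda_star M1 R1 R2 = Psi M1 R2 (max R1 (x0 M1 R2))"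

definition g :: "real \<Rightarrow> real \<Rightarrow> real \<Rightarrow> real \<Rightarrow> real" where
  "g M1 R1 R2 r = q M1 r - lambda_star M1 R1 R2 * A R2 r"

definition deficit :: "real \<Rightarrow> real \<Rightarrow> real \<Rightarrow> real \<Rightarrow> (real \<Rightarrow> real) \<Rightarrow> real" where
  "deficit M1 M2 R1 R2 u = J M1 M2 R1 R2 u - lambda_star M1 R1 R2"

end

theory Submission
  imports Defs
begin

text \<open>
  Testing \<open>Du\<close> against a cutoff of the antiderivative \<open>A\<close> of \<open>- r\<^sup>2\<close> and using the normalisation
  \<open>\<integral> r\<^sup>2 u = 1\<close> gives \<open>\<integral> A d\<mu> - \<integral> A d\<nu> = 1\<close>. Replacing the constant \<open>\<lambda>\<^sub>*\<close> in the deficit by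
  \<open>\<lambda>\<^sub>* (\<integral> A d\<mu> - \<integral> A d\<nu>)\<close> and inserting \<open>\<plusminus> q\<close> under the integral over \<open>\<mu>\<close> yields the identity.
  The first term is nonnegative because \<open>P\<^sub>u \<ge> 0\<close>, the second because \<open>\<lambda>\<^sub>*\<close> minimises \<open>q / A\<close>:
  the logarithmic derivative of \<open>\<Psi>\<close> has the sign of the cubic that defines \<open>x\<^sub>0\<close>.
\<close>

section \<open>Smooth cutoff functions\<close>

text \<open>The recursion peels off the innermost derivative, so each closure rule is an induction
  on the order with the function generalised. \<open>all_diff_upto_iff\<close> links it to the
  iterates of \<open>deriv\<close> in \<open>test_function\<close>.\<close>

primrec diff_upto :: "nat \<Rightarrow> (real \<Rightarrow> real) \<Rightarrow> bool" where
  "diff_upto 0 f \<longleftrightarrow> True"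
| "diff_upto (Suc n) f \<longleftrightarrow> (\<forall>x. f field_differentiable (at x)) \<and> diff_upto n (deriv f)"

lemma diff_upto_iff:
  "diff_upto n f \<longleftrightarrow> (\<forall>k<n. \<forall>x. (deriv ^^ k) f field_differentiable (at x))"
proof (induction n arbitrary: f)
  case (Suc n)
  show ?case
    by (simp add: Suc.IH All_less_Suc2 funpow_Suc_right del: funpow.simps(2))
qed simp

lemma all_diff_upto_iff:
  "(\<forall>n. diff_upto n f) \<longleftrightarrow> (\<forall>n x. (deriv ^^ n) f field_differentiable (at x))"
  unfolding diff_upto_iff by blast

text \<open>Any formula for the derivative coincides with \<open>deriv f\<close>, so the closure
  rules can work with closed expressions.\<close>

lemma diff_upto_SucI:
  assumes "\<And>x. (f has_real_derivative f' x) (at x)" and "diff_upto n f'"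
  shows "diff_upto (Suc n) f"
proof -
  have "deriv f = f'"
    using assms(1) DERIV_imp_deriv by blast
  then show ?thesis
    using assms by (auto simp: field_differentiable_def)
qed

lemma diff_upto_Suc_DERIV: "diff_upto (Suc n) f \<Longrightarrow> (f has_real_derivative deriv f x) (at x)"
  by (simp add: field_differentiable_derivI)

lemma diff_upto_SucD: "diff_upto (Suc n) f \<Longrightarrow> diff_upto n f"
  by (auto simp: diff_upto_iff)

section \<open>Closure rules for differentiability of finite order\<close>

lemma diff_upto_const: "diff_upto n (\<lambda>_. c)"
proof (induction n arbitrary: c)
  case (Suc n)
  show ?case by (rule diff_upto_SucI[where f' = "\<lambda>_. 0"]) (auto simp: Suc)
qed simp

lemma diff_upto_add:
  "diff_upto n f \<Longrightarrow> diff_upto n h \<Longrightarrow> diff_upto n (\<lambda>x. f x + h x)"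
proof (induction n arbitrary: f h)
  case (Suc n)
  show ?case
    by (rule diff_upto_SucI[OF DERIV_add[OF diff_upto_Suc_DERIV[OF Suc.prems(1)]
          diff_upto_Suc_DERIV[OF Suc.prems(2)]]])
      (use Suc in simp)
qed simp

lemma diff_upto_mult:
  "diff_upto n f \<Longrightarrow> diff_upto n h \<Longrightarrow> diff_upto n (\<lambda>x. f x * h x)"
proof (induction n arbitrary: f h)
  case (Suc n)
  have "diff_upto n (\<lambda>x. deriv f x * h x + deriv h x * f x)"
    using Suc.prems diff_upto_SucD[OF Suc.prems(1)] diff_upto_SucD[OF Suc.prems(2)]
    by (intro diff_upto_add Suc.IH) auto
  then show ?case
    by (rule diff_upto_SucI[OF DERIV_mult[OF diff_upto_Suc_DERIV[OF Suc.prems(1)]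
          diff_upto_Suc_DERIV[OF Suc.prems(2)]]])
qed simp

text \<open>The derivative \<open>- f' / f^2\<close> is built from \<open>inverse f\<close> and
  \<open>deriv f\<close>, both differentiable to the lower order, so the product rule closes the
  induction.\<close>

lemma diff_upto_inverse:
  "diff_upto n f \<Longrightarrow> (\<And>x. f x \<noteq> 0) \<Longrightarrow> diff_upto n (\<lambda>x. inverse (f x))"
proof (induction n arbitrary: f)
  case (Suc n)
  have IH: "diff_upto n (\<lambda>x. inverse (f x))"
    using Suc diff_upto_SucD by blast
  have "diff_upto n (\<lambda>x. - 1 * (inverse (f x) * deriv f x * inverse (f x)))"
    using Suc.prems(1) by (intro diff_upto_mult IH diff_upto_const) auto
  moreover have "((\<lambda>x. inverse (f x)) has_real_derivative
      - 1 * (inverse (f x) * deriv f x * inverse (f x))) (at x)" for x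
    using DERIV_inverse'[OF diff_upto_Suc_DERIV[OF Suc.prems(1)] Suc.prems(2)] by simp
  ultimately show ?case
    by (intro diff_upto_SucI)
qed simp

lemma diff_upto_affine:
  "diff_upto n f \<Longrightarrow> diff_upto n (\<lambda>x. f (c * x + d))"
proof (induction n arbitrary: f)
  case (Suc n)
  have "diff_upto n (\<lambda>x. deriv f (c * x + d) * c)"
    using Suc by (intro diff_upto_mult diff_upto_const) auto
  moreover have "((\<lambda>x. f (c * x + d)) has_real_derivative deriv f (c * x + d) * c) (at x)" for x
    by (rule DERIV_chain2[OF diff_upto_Suc_DERIV[OF Suc.prems]]) (auto intro!: derivative_eq_intros)
  ultimately show ?case
    by (intro diff_upto_SucI)
qed simp

lemma diff_upto_ident: "diff_upto n (\<lambda>x. x)"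
proof (cases n)
  case (Suc m)
  show ?thesis unfolding Suc
    by (rule diff_upto_SucI[where f' = "\<lambda>_. 1"]) (auto simp: diff_upto_const)
qed simp

lemma diff_upto_power: "diff_upto n (\<lambda>x. x ^ k)"
  by (induction k) (auto intro: diff_upto_const diff_upto_mult diff_upto_ident)

text \<open>
  The factor \<open>poly p (1 / x)\<close> makes the family of flat exponentials closed under differentiation.
\<close>

definition flat_exp :: "real poly \<Rightarrow> real \<Rightarrow> real" where
  "flat_exp p x = (if x > 0 then poly p (1 / x) * exp (- 1 / x) else 0)"

lemma tendsto_poly_div_exp_0: "((\<lambda>x. poly p x / exp x) \<longlongrightarrow> (0::real)) at_top"
proof -
  have "((\<lambda>x::real. \<Sum>i\<le>degree p. coeff p i * (x ^ i / exp x)) \<longlongrightarrow> 0) at_top"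
    by (intro tendsto_null_sum tendsto_mult_right_zero tendsto_power_div_exp_0)
  then show ?thesis
    by (simp add: poly_altdef sum_divide_distrib)
qed

text \<open>With \<open>t = 1 / x\<close>, the derivative of \<open>p(t) exp(- t)\<close> in
  \<open>x\<close> is \<open>t^2 (p - p')(t) exp(- t)\<close>, and \<open>[:0, 0, 1:]\<close> is the
  polynomial \<open>t^2\<close>. At 0 the exponential beats every power of \<open>t\<close>, so the
  difference quotient tends to 0 from the right.\<close>

lemma DERIV_flat_exp:
  "(flat_exp p has_real_derivative flat_exp ([:0, 0, 1:] * (p - pderiv p)) x) (at x)"
proof (cases "x = 0")
  case False
  show ?thesis
  proof (cases "x > 0")
    case True
    have "((\<lambda>x. poly p (1 / x) * exp (- 1 / x)) has_real_derivative
        flat_exp ([:0, 0, 1:] * (p - pderiv p)) x) (at x)"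
      unfolding flat_exp_def using True
      by (auto intro!: derivative_eq_intros DERIV_chain2[OF poly_DERIV] simp: field_simps power2_eq_square)
    then show ?thesis
      by (rule has_field_derivative_transform_within_open[where S = "{0<..}"])
        (use True in \<open>auto simp: flat_exp_def\<close>)
  next
    case neg: False
    have "((\<lambda>x. 0) has_real_derivative flat_exp ([:0, 0, 1:] * (p - pderiv p)) x) (at x)"
      using neg by (simp add: flat_exp_def)
    then show ?thesis
      by (rule has_field_derivative_transform_within_open[where S = "{..<0}"])
        (use neg False in \<open>auto simp: flat_exp_def\<close>)
  qed
next
  case True
  have "((\<lambda>y. flat_exp p y / y) \<longlongrightarrow> 0) (at_right 0)"
  proof -
    \<comment> \<open>Dividing by \<open>y\<close> contributes a factor \<open>1 / y\<close>, which
      is the shift from \<open>p\<close> to \<open>pCons 0 p\<close>.\<close>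
    have "((\<lambda>y. poly (pCons 0 p) (inverse y) / exp (inverse y)) \<longlongrightarrow> 0) (at_right (0::real))"
      using tendsto_poly_div_exp_0 filterlim_inverse_at_top_right by (rule filterlim_compose)
    moreover have "\<forall>\<^sub>F y in at_right 0.
        poly (pCons 0 p) (inverse y) / exp (inverse y) = flat_exp p y / y"
      unfolding eventually_at_right_field
      by (intro exI[of _ 1]) (auto simp: flat_exp_def exp_minus field_simps)
    ultimately show ?thesis
      by (rule Lim_transform_eventually)
  qed
  moreover have "((\<lambda>y. flat_exp p y / y) \<longlongrightarrow> 0) (at_left 0)"
    by (rule tendsto_eventually)
      (auto simp: eventually_at_left_field flat_exp_def intro!: exI[of _ "-1"])
  ultimately have "((\<lambda>y. flat_exp p y / y) \<longlongrightarrow> 0) (at 0)"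
    by (simp add: filterlim_at_split)
  then show ?thesis
    unfolding True by (simp add: DERIV_def flat_exp_def)
qed

lemma diff_upto_flat_exp: "diff_upto n (flat_exp p)"
  by (induction n arbitrary: p) (auto intro!: diff_upto_SucI DERIV_flat_exp simp del: diff_upto.simps(2))

section \<open>A smooth transition from 0 to 1, and cutoffs of open intervals\<close>

definition smooth_step :: "real \<Rightarrow> real" where
  "smooth_step x = flat_exp 1 x * inverse (flat_exp 1 x + flat_exp 1 (1 - x))"

text \<open>At least one of \<open>x\<close> and \<open>1 - x\<close> is positive, and neither
  summand is ever negative.\<close>

lemma smooth_step_denominator_pos: "flat_exp 1 x + flat_exp 1 (1 - x) > 0"
  by (cases "x > 0") (auto simp: flat_exp_def add_pos_nonneg)

lemma diff_upto_smooth_step: "diff_upto n smooth_step"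
proof -
  have "diff_upto n (\<lambda>x. flat_exp 1 (1 - x))"
    using diff_upto_affine[OF diff_upto_flat_exp, of n 1 "-1" 1] by simp
  then show ?thesis
    unfolding smooth_step_def[abs_def] using smooth_step_denominator_pos
    by (intro diff_upto_mult diff_upto_inverse diff_upto_add diff_upto_flat_exp)
      (auto simp: less_imp_neq[THEN not_sym])
qed

lemma smooth_step_eq_0: "x \<le> 0 \<Longrightarrow> smooth_step x = 0"
  by (simp add: smooth_step_def flat_exp_def)

lemma smooth_step_eq_1: "x \<ge> 1 \<Longrightarrow> smooth_step x = 1"
  by (simp add: smooth_step_def flat_exp_def)

lemma smooth_step_bounds: "0 \<le> smooth_step x" "smooth_step x \<le> 1"
  using smooth_step_denominator_pos[of x]
  by (auto simp: smooth_step_def flat_exp_def field_simps)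

text \<open>For \<open>k > 0\<close> this is 1 on \<open>[a + 1/k, b - 1/k]\<close> and 0 outside
  \<open>(a, b)\<close>, so increasing \<open>k\<close> exhausts the open interval from
  inside.\<close>

definition cutoff :: "real \<Rightarrow> real \<Rightarrow> real \<Rightarrow> real \<Rightarrow> real" where
  "cutoff a b k x = smooth_step (k * (x - a)) * smooth_step (k * (b - x))"

lemma diff_upto_cutoff: "diff_upto n (cutoff a b k)"
proof -
  have "diff_upto n (\<lambda>x. smooth_step (k * x + - (k * a)) * smooth_step (- k * x + k * b))"
    by (intro diff_upto_mult diff_upto_affine diff_upto_smooth_step)
  then show ?thesis
    by (simp add: cutoff_def[abs_def] algebra_simps)
qed

lemma cutoff_eq_0: "k \<ge> 0 \<Longrightarrow> x \<notin> {a<..<b} \<Longrightarrow> cutoff a b k x = 0"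
  by (auto simp: cutoff_def smooth_step_eq_0 mult_nonneg_nonpos not_less)

lemma cutoff_eq_1: "1 \<le> k * (x - a) \<Longrightarrow> 1 \<le> k * (b - x) \<Longrightarrow> cutoff a b k x = 1"
  by (simp add: cutoff_def smooth_step_eq_1)

lemma cutoff_bounds: "0 \<le> cutoff a b k x" "cutoff a b k x \<le> 1"
  by (auto simp: cutoff_def smooth_step_bounds mult_le_one)

text \<open>Both factors are eventually 1 at an interior point, while at the endpoints every cutoff
  is 0. The limit therefore ignores atoms at \<open>a\<close> and \<open>b\<close>.\<close>

lemma cutoff_tendsto_indicator:
  "(\<lambda>n. cutoff a b (real n) x) \<longlonglongrightarrow> indicator {a<..<b} x"
proof (cases "x \<in> {a<..<b}")
  case True
  have ev: "\<forall>\<^sub>F n in sequentially. 1 \<le> real n * t" if "t > 0" for t :: real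
  proof -
    have "filterlim (\<lambda>n. real n * t) at_top sequentially"
      using that by (intro filterlim_at_top_mult_tendsto_pos[OF tendsto_const] filterlim_real_sequentially) auto
    then show ?thesis
      by (simp add: filterlim_at_top)
  qed
  have "\<forall>\<^sub>F n in sequentially. 1 \<le> real n * (x - a)" "\<forall>\<^sub>F n in sequentially. 1 \<le> real n * (b - x)"
    using True by (auto intro: ev)
  then have "\<forall>\<^sub>F n in sequentially. cutoff a b (real n) x = 1"
    by eventually_elim (rule cutoff_eq_1)
  then show ?thesis
    using True by (simp add: tendsto_eventually)
qed (simp add: cutoff_eq_0)

lemma test_function_mult_cutoff:
  assumes "\<And>n. diff_upto n f" "k \<ge> 0"
  shows "test_function (\<lambda>x. f x * cutoff a b k x)"
  unfolding test_function_def
proof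
  have "\<forall>n. diff_upto n (\<lambda>x. f x * cutoff a b k x)"
    by (intro allI diff_upto_mult assms diff_upto_cutoff)
  then show "\<forall>n x. (deriv ^^ n) (\<lambda>x. f x * cutoff a b k x) field_differentiable (at x)"
    unfolding all_diff_upto_iff .
  have "cutoff a b k x = 0" if "x \<notin> {a..b}" for x
    using that by (intro cutoff_eq_0 assms) auto
  then have "{x. f x * cutoff a b k x \<noteq> 0} \<subseteq> {a..b}"
    by fastforce
  then show "compact (closure {x. f x * cutoff a b k x \<noteq> 0})"
    using bounded_subset[OF bounded_closed_interval] by (simp add: compact_closure)
qed

lemma test_function_cutoff: "k \<ge> 0 \<Longrightarrow> test_function (cutoff a b k)"
  using test_function_mult_cutoff[OF diff_upto_const[of _ 1]] by simp

section \<open>Measurability, boundedness and integrability of test functions\<close>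

lemma test_function_differentiable: "test_function \<phi> \<Longrightarrow> \<phi> field_differentiable (at x)"
  unfolding test_function_def by (metis funpow_0)

lemma test_function_borel_measurable: "test_function \<phi> \<Longrightarrow> \<phi> \<in> borel_measurable borel"
  by (intro borel_measurable_continuous_onI continuous_at_imp_continuous_on)
    (auto intro: field_differentiable_imp_continuous_at test_function_differentiable)

lemma test_function_deriv_borel_measurable:
  assumes "test_function \<phi>"
  shows "deriv \<phi> \<in> borel_measurable borel"
proof -
  have "(deriv ^^ 1) \<phi> field_differentiable (at x)" for x
    using assms unfolding test_function_def by blast
  then show ?thesis
    by (intro borel_measurable_continuous_onI continuous_at_imp_continuous_on)
      (auto intro: field_differentiable_imp_continuous_at)
qed

lemma test_function_bounded:
  assumes "test_function \<phi>"
  obtains C where "\<And>x. \<bar>\<phi> x\<bar> \<le> C"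
proof -
  have "continuous_on (closure {x. \<phi> x \<noteq> 0}) \<phi>"
    using assms by (intro continuous_at_imp_continuous_on)
      (auto intro: field_differentiable_imp_continuous_at test_function_differentiable)
  then have "bounded (\<phi> ` closure {x. \<phi> x \<noteq> 0})"
    using assms unfolding test_function_def by (intro compact_imp_bounded compact_continuous_image) auto
  then obtain C where C: "\<And>x. x \<in> closure {x. \<phi> x \<noteq> 0} \<Longrightarrow> \<bar>\<phi> x\<bar> \<le> C"
    by (auto simp: bounded_iff)
  \<comment> \<open>\<open>C\<close> is a bound on the closed support only, and could be negative if
    that set is empty; the maximum with 0 covers the zeros of \<open>\<phi>\<close>.\<close>
  have "\<bar>\<phi> x\<bar> \<le> max C 0" for x
  proof (cases "\<phi> x = 0")
    case False
    then show ?thesis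
      using C[of x] closure_subset[of "{x. \<phi> x \<noteq> 0}"] by (auto simp: le_max_iff_disj)
  qed simp
  then show thesis ..
qed

lemma test_function_integrable:
  assumes "test_function \<phi>" "finite_measure M" "sets M = sets borel"
  shows "integrable M \<phi>"
proof -
  obtain C where "\<And>x. \<bar>\<phi> x\<bar> \<le> C"
    using test_function_bounded[OF assms(1)] by blast
  moreover have "\<phi> \<in> borel_measurable M"
    using test_function_borel_measurable[OF assms(1)]
    by (simp add: measurable_cong_sets[OF assms(3) refl])
  ultimately show ?thesis
    by (intro finite_measure.integrable_const_bound[OF assms(2), of _ C]) auto
qed

lemma integral_cutoff_tendsto:
  assumes "finite_measure M" "sets M = sets borel"
  shows "(\<lambda>n. LINT x|M. cutoff a b (real n) x) \<longlonglongrightarrow> measure M {a<..<b}"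
proof -
  interpret finite_measure M by fact
  have "(\<lambda>n. LINT x|M. cutoff a b (real n) x) \<longlonglongrightarrow> (LINT x|M. indicator {a<..<b} x)"
  proof (rule integral_dominated_convergence[where w = "\<lambda>_. 1"])
    show "(\<lambda>x. cutoff a b (real n) x) \<in> borel_measurable M" for n
      using test_function_borel_measurable[OF test_function_cutoff]
      by (simp add: measurable_cong_sets[OF assms(2) refl])
  qed (use cutoff_tendsto_indicator cutoff_bounds assms in auto)
  then show ?thesis
    using assms(2) by (simp add: sets_eq_imp_space_eq[OF assms(2)])
qed

section \<open>Jordan decomposition of the derivative\<close>

lemma borel_eq_sigma_sets_intervals:
  "sets borel = sigma_sets UNIV (range (\<lambda>(a, b). {a<..<b::real}))"
proof -
  have "borel = sigma UNIV (range (\<lambda>(a, b). {a<..<b::real}))"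
    using borel_eq_box[where 'a = real] by (simp add: case_prod_unfold box_real image_def)
  then show ?thesis
    by (metis sets_measure_of subset_UNIV Pow_UNIV)
qed

text \<open>Dynkin's argument for differences of finite measures: the sets on which the defect
  \<open>d\<close> vanishes form a lambda-system containing the intersection-stable family of open
  intervals. Taking \<open>U = UNIV\<close> gives uniqueness of the derivative; a half-line
  \<open>U\<close> localises the comparison.\<close>

lemma signed_measure_eqI:
  fixes \<mu>1 \<mu>2 \<nu>1 \<nu>2 :: "real measure"
  assumes fin: "finite_measure \<mu>1" "finite_measure \<nu>1" "finite_measure \<mu>2" "finite_measure \<nu>2"
    and sets: "sets \<mu>1 = sets borel" "sets \<nu>1 = sets borel" "sets \<mu>2 = sets borel" "sets \<nu>2 = sets borel"
    and U: "U \<in> sets borel"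
    and eq: "\<And>a b. measure \<mu>1 ({a<..<b} \<inter> U) - measure \<nu>1 ({a<..<b} \<inter> U)
                  = measure \<mu>2 ({a<..<b} \<inter> U) - measure \<nu>2 ({a<..<b} \<inter> U)"
    and B: "B \<in> sets borel"
  shows "measure \<mu>1 (B \<inter> U) - measure \<nu>1 (B \<inter> U) = measure \<mu>2 (B \<inter> U) - measure \<nu>2 (B \<inter> U)"
proof -
  define d where "d X = (measure \<mu>1 (X \<inter> U) - measure \<nu>1 (X \<inter> U))
    - (measure \<mu>2 (X \<inter> U) - measure \<nu>2 (X \<inter> U))" for X
  have union: "(\<lambda>i. d (X i)) sums d (\<Union>i. X i)" if "range X \<subseteq> sets borel" "disjoint_family X" for X
  proof -
    have "(\<lambda>i. measure M (X i \<inter> U)) sums measure M ((\<Union>i. X i) \<inter> U)"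
      if "finite_measure M" "sets M = sets borel" for M
    proof -
      have "range (\<lambda>i. X i \<inter> U) \<subseteq> sets M" "disjoint_family (\<lambda>i. X i \<inter> U)"
        using \<open>range X \<subseteq> sets borel\<close> \<open>disjoint_family X\<close> U that by (auto simp: disjoint_family_on_def)
      from finite_measure.finite_measure_UNION[OF that(1) this] show ?thesis
        by simp
    qed
    then show ?thesis
      unfolding d_def using fin sets by (intro sums_diff) blast+
  qed
  have compl: "d (UNIV - X) = d UNIV - d X" if "X \<in> sets borel" for X
  proof -
    have "measure M ((UNIV - X) \<inter> U) = measure M (UNIV \<inter> U) - measure M (X \<inter> U)"
      if "finite_measure M" "sets M = sets borel" for M
    proof -
      have "(UNIV - X) \<inter> U = U - X \<inter> U" by auto
      then show ?thesis
        using finite_measure.finite_measure_Diff[OF that(1), of U "X \<inter> U"] \<open>X \<in> sets borel\<close> U that(2)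
        by auto
    qed
    then show ?thesis
      unfolding d_def using fin sets by simp
  qed
  \<comment> \<open>The whole line is not a bounded interval, so it is exhausted by
    \<open>(-n, n)\<close> and continuity from below is used.\<close>
  have UNIV0: "d UNIV = 0"
  proof -
    have "(\<lambda>n. measure M ({- real n<..<real n} \<inter> U)) \<longlonglongrightarrow> measure M (UNIV \<inter> U)"
      if "finite_measure M" "sets M = sets borel" for M
    proof -
      have "(\<Union>n. {- real n<..<real n}) = UNIV"
      proof (intro set_eqI iffI UNIV_I)
        fix x :: real
        obtain n where "\<bar>x\<bar> < real n" using reals_Archimedean2 by blast
        then have "x \<in> {- real n<..<real n}" by auto
        then show "x \<in> (\<Union>n. {- real n<..<real n})" by blast
      qed
      then have "(\<Union>n. {- real n<..<real n} \<inter> U) = UNIV \<inter> U"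
        by blast
      moreover have "range (\<lambda>n. {- real n<..<real n} \<inter> U) \<subseteq> sets M"
        unfolding that(2) using U by (intro image_subsetI sets.Int) simp_all
      moreover have "incseq (\<lambda>n. {- real n<..<real n} \<inter> U)"
        by (intro monoI Int_mono order_refl greaterThanLessThan_subseteq_greaterThanLessThan[THEN iffD2]) simp
      ultimately show ?thesis
        using finite_measure.finite_Lim_measure_incseq[OF that(1), of "\<lambda>n. {- real n<..<real n} \<inter> U"]
        by simp
    qed
    then have "(\<lambda>n. d {- real n<..<real n}) \<longlonglongrightarrow> d UNIV"
      unfolding d_def using fin sets by (intro tendsto_diff) blast+
    moreover have "d {- real n<..<real n} = 0" for n
      using eq by (simp add: d_def)
    ultimately show ?thesis
      by (simp add: LIMSEQ_const_iff)
  qed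
  have "d B = 0"
  proof (rule sigma_sets_induct_disjoint[of "range (\<lambda>(a, b). {a<..<b::real})" UNIV])
    show "Int_stable (range (\<lambda>(a, b). {a<..<b::real}))"
    proof (rule Int_stableI_image, clarify)
      fix a b c d :: real
      have "{a<..<b} \<inter> {c<..<d} = {max a c<..<min b d}" by auto
      then show "\<exists>k\<in>UNIV. {a<..<b} \<inter> {c<..<d} = (case k of (a, b) \<Rightarrow> {a<..<b})"
        by auto
    qed
    show "B \<in> sigma_sets UNIV (range (\<lambda>(a, b). {a<..<b::real}))"
      using B by (simp add: borel_eq_sigma_sets_intervals)
    show "d X = 0" if "X \<in> range (\<lambda>(a, b). {a<..<b::real})" for X
      using that eq by (auto simp: d_def)
    show "d {} = 0"
      by (simp add: d_def)
    show "d (UNIV - X) = 0" if "X \<in> sigma_sets UNIV (range (\<lambda>(a, b). {a<..<b::real}))" "d X = 0" for X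
      using compl[of X] that UNIV0 by (simp add: borel_eq_sigma_sets_intervals)
    show "d (\<Union>i::nat. X i) = 0"
      if "disjoint_family X" "range X \<subseteq> sigma_sets UNIV (range (\<lambda>(a, b). {a<..<b::real}))"
        "\<And>i. d (X i) = 0" for X
      using union[of X] that by (auto simp: borel_eq_sigma_sets_intervals dest: sums_unique2[OF sums_zero])
  qed simp
  then show ?thesis
    by (simp add: d_def)
qed

lemma measure_cutoff_tendsto:
  assumes "has_measure_derivative u \<mu> \<nu>"
  shows "(\<lambda>n. (LINT x|\<mu>. cutoff a b (real n) x) - (LINT x|\<nu>. cutoff a b (real n) x))
    \<longlonglongrightarrow> measure \<mu> {a<..<b} - measure \<nu> {a<..<b}"
  using assms by (auto simp: has_measure_derivative_def intro!: tendsto_diff integral_cutoff_tendsto)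

lemma has_measure_derivative_test:
  "has_measure_derivative u \<mu> \<nu> \<Longrightarrow> test_function \<phi> \<Longrightarrow>
    (LINT x|\<mu>. \<phi> x) - (LINT x|\<nu>. \<phi> x) = - (LINT x|lebesgue. u x * deriv \<phi> x)"
  by (auto simp: has_measure_derivative_def)

text \<open>Both pairs take the same values on every cutoff, since these depend on \<open>u\<close>
  alone. The limit transfers this to open intervals, and from there to all Borel sets.\<close>

lemma has_measure_derivative_unique:
  assumes 1: "has_measure_derivative u \<mu>1 \<nu>1" and 2: "has_measure_derivative u \<mu>2 \<nu>2"
    and B: "B \<in> sets borel"
  shows "measure \<mu>1 B - measure \<nu>1 B = measure \<mu>2 B - measure \<nu>2 B"
proof -
  have "measure \<mu>1 {a<..<b} - measure \<nu>1 {a<..<b} = measure \<mu>2 {a<..<b} - measure \<nu>2 {a<..<b}" for a b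
  proof (rule LIMSEQ_unique[OF measure_cutoff_tendsto[OF 1]])
    show "(\<lambda>n. (LINT x|\<mu>1. cutoff a b (real n) x) - (LINT x|\<nu>1. cutoff a b (real n) x))
      \<longlonglongrightarrow> measure \<mu>2 {a<..<b} - measure \<nu>2 {a<..<b}"
      using measure_cutoff_tendsto[OF 2, of a b]
      by (simp add: has_measure_derivative_test[OF 1] has_measure_derivative_test[OF 2] test_function_cutoff)
  qed
  then show ?thesis
    using signed_measure_eqI[of \<mu>1 \<nu>1 \<mu>2 \<nu>2 UNIV B] 1 2 B by (simp add: has_measure_derivative_def)
qed

text \<open>
  On the set carrying \<open>\<mu>1\<close> the signed measure is \<open>\<mu>1\<close> itself, so \<open>\<mu>1\<close> is the
  supremum of the signed measure over subsets.
\<close>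

lemma mutually_singular_measure_le:
  assumes fin: "finite_measure \<mu>1" "finite_measure \<nu>1" "finite_measure \<mu>2" "finite_measure \<nu>2"
    and sets: "sets \<mu>1 = sets borel" "sets \<nu>1 = sets borel" "sets \<mu>2 = sets borel" "sets \<nu>2 = sets borel"
    and eq: "\<And>B. B \<in> sets borel \<Longrightarrow> measure \<mu>1 B - measure \<nu>1 B = measure \<mu>2 B - measure \<nu>2 B"
    and sing: "mutually_singular \<mu>1 \<nu>1"
    and B: "B \<in> sets borel"
  shows "measure \<mu>1 B \<le> measure \<mu>2 B"
proof -
  \<comment> \<open>\<open>N\<close> is null for \<open>\<mu>1\<close> and carries
    \<open>\<nu>1\<close>. Removing it from \<open>B\<close> costs no \<open>\<mu>1\<close>-mass and
    leaves no \<open>\<nu>1\<close>-mass.\<close>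
  obtain N where N: "N \<in> sets borel" "emeasure \<mu>1 N = 0" "emeasure \<nu>1 (UNIV - N) = 0"
    using sing by (auto simp: mutually_singular_def sets sets_eq_imp_space_eq[OF sets(2)])
  have "measure \<mu>1 B \<le> measure \<mu>1 (B - N) + measure \<mu>1 N"
    using measure_Un_le[of "B - N" \<mu>1 N]
      finite_measure.finite_measure_mono[OF fin(1), of B "(B - N) \<union> N"] B N(1) sets(1) by auto
  also have "measure \<mu>1 N = 0"
    using N(2) by (simp add: measure_def)
  also have "measure \<nu>1 (B - N) = 0"
  proof -
    have "emeasure \<nu>1 (B - N) \<le> emeasure \<nu>1 (UNIV - N)"
      using N(1) B sets(2) by (intro emeasure_mono) auto
    then show ?thesis
      using N(3) by (simp add: measure_def)
  qed
  then have "measure \<mu>1 (B - N) + 0 = measure \<mu>2 (B - N) - measure \<nu>2 (B - N)"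
    using eq[of "B - N"] B N(1) by auto
  also have "\<dots> \<le> measure \<mu>2 B"
    using finite_measure.finite_measure_mono[OF fin(3), of "B - N" B] B sets(3)
    by (auto intro: order_trans[OF _ finite_measure.finite_measure_mono[OF fin(3), of "B - N" B]] simp: measure_nonneg)
  finally show ?thesis .
qed

text \<open>Each positive part is minimal, so the two dominate each other; the negative parts then
  agree because the differences do.\<close>

lemma jordan_pair_unique:
  assumes 1: "has_measure_derivative u \<mu>1 \<nu>1" "mutually_singular \<mu>1 \<nu>1"
    and 2: "has_measure_derivative u \<mu>2 \<nu>2" "mutually_singular \<mu>2 \<nu>2"
  shows "\<mu>1 = \<mu>2 \<and> \<nu>1 = \<nu>2"
proof -
  have fin: "finite_measure \<mu>1" "finite_measure \<nu>1" "finite_measure \<mu>2" "finite_measure \<nu>2"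
    and sets: "sets \<mu>1 = sets borel" "sets \<nu>1 = sets borel" "sets \<mu>2 = sets borel" "sets \<nu>2 = sets borel"
    using 1(1) 2(1) by (auto simp: has_measure_derivative_def)
  note eq = has_measure_derivative_unique[OF 1(1) 2(1)]
  have \<mu>: "measure \<mu>1 B = measure \<mu>2 B" if "B \<in> sets borel" for B
    using mutually_singular_measure_le[OF fin sets eq 1(2) that]
      mutually_singular_measure_le[OF fin(3,4,1,2) sets(3,4,1,2) eq[symmetric] 2(2) that] by simp
  then have "measure \<nu>1 B = measure \<nu>2 B" if "B \<in> sets borel" for B
    using eq[OF that] that by simp
  with \<mu> show ?thesis
    by (intro conjI measure_eqI)
      (simp_all add: sets fin[THEN finite_measure.emeasure_eq_measure])
qed

section \<open>Existence of the Jordan pair\<close>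

lemma measurable_diff_measure_iff:
  assumes "sets M = sets N"
  shows "f \<in> borel_measurable (diff_measure M N) \<longleftrightarrow> f \<in> borel_measurable M"
    "f \<in> borel_measurable N \<longleftrightarrow> f \<in> borel_measurable M"
  using assms by (simp_all cong: measurable_cong_sets)

text \<open>The additive form avoids the truncated subtraction of \<open>ennreal\<close>. The proof
  is the standard induction from indicators through sums to monotone limits.\<close>

lemma nn_integral_diff_measure:
  assumes fin: "finite_measure M" "finite_measure N" and sets: "sets M = sets N"
    and le: "\<And>X. X \<in> sets M \<Longrightarrow> emeasure N X \<le> emeasure M X"
    and f: "f \<in> borel_measurable M"
  shows "(\<integral>\<^sup>+ x. f x \<partial>diff_measure M N) + (\<integral>\<^sup>+ x. f x \<partial>N) = (\<integral>\<^sup>+ x. f x \<partial>M)"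
  using f
proof (induction rule: borel_measurable_induct)
  case (cong f g)
  have "(\<integral>\<^sup>+ x. f x \<partial>K) = (\<integral>\<^sup>+ x. g x \<partial>K)" if "space K = space M" for K
    using that cong(3) by (intro nn_integral_cong) auto
  then show ?case
    using cong(4) sets_eq_imp_space_eq[OF sets] by simp
next
  case (set X)
  have "X \<in> sets N" "X \<in> sets (diff_measure M N)"
    using set sets by auto
  then show ?case
    using set le emeasure_diff_measure[OF fin sets le, of X]
    by (simp add: diff_add_cancel_ennreal)
next
  case (mult f c)
  have "f \<in> borel_measurable N" "f \<in> borel_measurable (diff_measure M N)"
    using mult(2) by (auto simp: measurable_diff_measure_iff[OF sets])
  with mult show ?case
    by (simp add: nn_integral_cmult flip: distrib_left)
next
  case (add f g)
  have "f \<in> borel_measurable N" "f \<in> borel_measurable (diff_measure M N)"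
    "g \<in> borel_measurable N" "g \<in> borel_measurable (diff_measure M N)"
    using add by (auto simp: measurable_diff_measure_iff[OF sets])
  then have "(\<integral>\<^sup>+ x. f x + g x \<partial>diff_measure M N) + (\<integral>\<^sup>+ x. f x + g x \<partial>N) =
      ((\<integral>\<^sup>+ x. f x \<partial>diff_measure M N) + (\<integral>\<^sup>+ x. f x \<partial>N))
      + ((\<integral>\<^sup>+ x. g x \<partial>diff_measure M N) + (\<integral>\<^sup>+ x. g x \<partial>N))"
    by (simp add: nn_integral_add ac_simps)
  then show ?case
    using add by (simp add: nn_integral_add add.commute)
next
  case (seq F)
  have F_meas: "F i \<in> borel_measurable N" "F i \<in> borel_measurable (diff_measure M N)" for i
    using seq by (auto simp: measurable_diff_measure_iff[OF sets])
  have *: "(\<integral>\<^sup>+ x. (SUP i. F i x) \<partial>K) = (SUP i. \<integral>\<^sup>+ x. F i x \<partial>K)"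
    if "\<And>i. F i \<in> borel_measurable K" for K
    using seq.hyps(3) that by (rule nn_integral_monotone_convergence_SUP)
  \<comment> \<open>Monotonicity of both sequences of integrals allows the supremum of their sums to
    be split.\<close>
  have inc: "incseq (\<lambda>i. \<integral>\<^sup>+ x. F i x \<partial>K)" for K
    using seq.hyps(3) by (auto simp: incseq_def le_fun_def intro!: nn_integral_mono)
  show ?case
    by (simp only: SUP_apply) (simp add: seq.IH *[OF F_meas(1)] *[OF F_meas(2)] *[OF seq.hyps(1)] inc flip: ennreal_SUP_add)
qed

text \<open>The nonnegative identity is applied to the positive and negative parts of
  \<open>f\<close>; integrability makes all terms finite, so it can be read in the reals and
  rearranged.\<close>

lemma integral_diff_measure:
  fixes f :: "'a \<Rightarrow> real"
  assumes fin: "finite_measure M" "finite_measure N" and sets: "sets M = sets N"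
    and le: "\<And>X. X \<in> sets M \<Longrightarrow> emeasure N X \<le> emeasure M X"
    and f: "integrable M f"
  shows "integral\<^sup>L (diff_measure M N) f = integral\<^sup>L M f - integral\<^sup>L N f"
proof -
  have [measurable]: "f \<in> borel_measurable M"
    using f by auto
  then have [measurable]: "f \<in> borel_measurable N" "f \<in> borel_measurable (diff_measure M N)"
    by (simp_all add: measurable_diff_measure_iff[OF sets])
  note nn = nn_integral_diff_measure[OF fin sets le]
  \<comment> \<open>Each summand of the additive identity is at most the total, so integrability
    over \<open>M\<close> passes to \<open>N\<close> and to the difference.\<close>
  have le_M: "(\<integral>\<^sup>+ x. h x \<partial>diff_measure M N) \<le> (\<integral>\<^sup>+ x. h x \<partial>M)" "(\<integral>\<^sup>+ x. h x \<partial>N) \<le> (\<integral>\<^sup>+ x. h x \<partial>M)"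
    if "h \<in> borel_measurable M" for h
    using nn[OF _ that] by (metis order_refl add_increasing2 add_increasing zero_le)+
  have D: "integrable (diff_measure M N) f"
    using f le_M(1)[of "\<lambda>x. ennreal (norm (f x))"] by (auto simp: integrable_iff_bounded)
  have N: "integrable N f"
    using f le_M(2)[of "\<lambda>x. ennreal (norm (f x))"] by (auto simp: integrable_iff_bounded)
  have "enn2real (\<integral>\<^sup>+ x. ennreal (h x) \<partial>diff_measure M N) + enn2real (\<integral>\<^sup>+ x. ennreal (h x) \<partial>N)
      = enn2real (\<integral>\<^sup>+ x. ennreal (h x) \<partial>M)"
    if "integrable M h" "integrable N h" "integrable (diff_measure M N) h" for h :: "_ \<Rightarrow> real"
    using that nn[of "\<lambda>x. ennreal (h x)"]
    by (subst enn2real_plus[symmetric]) (auto simp: real_integrable_def less_top)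
  from this[of f] this[of "\<lambda>x. - f x"] show "integral\<^sup>L (diff_measure M N) f = integral\<^sup>L M f - integral\<^sup>L N f"
    using f D N by (simp add: real_lebesgue_integral_def)
qed

text \<open>On a Hahn set \<open>Y\<close> the measure \<open>\<mu>\<close> dominates
  \<open>\<nu>\<close>, on its complement the reverse holds. Subtracting the smaller measure on each
  piece cancels the common mass and leaves the signed measure unchanged.\<close>

lemma jordan_pair_exists:
  assumes "has_measure_derivative u \<mu> \<nu>"
  shows "\<exists>\<mu>' \<nu>'. has_measure_derivative u \<mu>' \<nu>' \<and> mutually_singular \<mu>' \<nu>'"
proof -
  have fin: "finite_measure \<mu>" "finite_measure \<nu>"
    and sets[measurable_cong, simp]: "sets \<mu> = sets borel" "sets \<nu> = sets borel"
    using assms by (auto simp: has_measure_derivative_def)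
  obtain Y where Y[measurable]: "Y \<in> sets borel"
    and pos: "\<And>X. X \<in> sets borel \<Longrightarrow> X \<subseteq> Y \<Longrightarrow> emeasure \<nu> X \<le> emeasure \<mu> X"
    and neg: "\<And>X. X \<in> sets borel \<Longrightarrow> X \<inter> Y = {} \<Longrightarrow> emeasure \<mu> X \<le> emeasure \<nu> X"
    using finite_unsigned_Hahn_decomposition[OF fin] by auto
  \<comment> \<open>Restriction to \<open>Z\<close> by a density keeps the full Borel sigma-algebra,
    as \<open>has_measure_derivative\<close> demands.\<close>
  define R where "R M Z = density M (indicator Z)" for M :: "real measure" and Z
  have R_sets[simp]: "sets (R M Z) = sets M" for M Z
    by (simp add: R_def)
  have R_emeasure: "emeasure (R M Z) X = emeasure M (Z \<inter> X)"
    if "Z \<in> sets M" "X \<in> sets M" for M Z X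
    using that by (simp add: R_def emeasure_restricted)
  have R_fin: "finite_measure (R M Z)" if "finite_measure M" "Z \<in> sets M" for M Z
    using that R_emeasure[OF that(2) sets.top]
    by (intro finite_measureI)
      (simp add: R_def sets.Int_space_eq2 finite_measure.emeasure_finite)
  have R_int: "integrable (R M Z) f" "integral\<^sup>L (R M Z) f = (LINT x:Z|M. f x)"
    if "integrable M f" "Z \<in> sets M" for M Z and f :: "real \<Rightarrow> real"
  proof -
    have *: "R M Z = density M (\<lambda>x. ennreal (indicator Z x))"
      by (simp add: R_def ennreal_indicator)
    show "integrable (R M Z) f" "integral\<^sup>L (R M Z) f = (LINT x:Z|M. f x)"
      unfolding * using that integrable_mult_indicator[OF that(2,1)]
      by (auto simp: integrable_density integral_density set_lebesgue_integral_def)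
  qed
  define \<mu>' where "\<mu>' = diff_measure (R \<mu> Y) (R \<nu> Y)"
  define \<nu>' where "\<nu>' = diff_measure (R \<nu> (- Y)) (R \<mu> (- Y))"
  have le: "emeasure (R \<nu> Y) X \<le> emeasure (R \<mu> Y) X" "emeasure (R \<mu> (- Y)) X \<le> emeasure (R \<nu> (- Y)) X"
    if "X \<in> sets borel" for X
    using that by (auto simp: R_emeasure intro!: pos neg)
  have em: "emeasure \<mu>' X = emeasure (R \<mu> Y) X - emeasure (R \<nu> Y) X"
    "emeasure \<nu>' X = emeasure (R \<nu> (- Y)) X - emeasure (R \<mu> (- Y)) X"
    if "X \<in> sets borel" for X
    using that fin le unfolding \<mu>'_def \<nu>'_def by (auto intro!: emeasure_diff_measure R_fin)
  have [simp]: "sets \<mu>' = sets borel" "sets \<nu>' = sets borel"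
    by (simp_all add: \<mu>'_def \<nu>'_def)
  have sp': "space \<mu>' = UNIV" "space \<nu>' = UNIV"
    using sets_eq_imp_space_eq[of \<mu>' borel] sets_eq_imp_space_eq[of \<nu>' borel] by auto
  have fin': "finite_measure \<mu>'" "finite_measure \<nu>'"
    using fin by (auto intro!: finite_measureI simp: sp' em R_emeasure finite_measure.emeasure_finite)
  \<comment> \<open>\<open>\<mu>'\<close> lives on \<open>Y\<close> and \<open>\<nu>'\<close> on its
    complement, so \<open>- Y\<close> is the separating set.\<close>
  have "mutually_singular \<mu>' \<nu>'"
    unfolding mutually_singular_def
    by (intro bexI[of _ "- Y"]) (auto simp: em sp' R_emeasure)
  moreover have "has_measure_derivative u \<mu>' \<nu>'"
    unfolding has_measure_derivative_def
  proof (intro conjI allI impI)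
    fix \<phi> assume \<phi>: "test_function \<phi>"
    have int: "integrable \<mu> \<phi>" "integrable \<nu> \<phi>"
      using fin by (auto intro: test_function_integrable[OF \<phi>])
    have split: "integral\<^sup>L M \<phi> = (LINT x:Y|M. \<phi> x) + (LINT x:- Y|M. \<phi> x)"
      if "integrable M \<phi>" "sets M = sets borel" for M
    proof -
      have "integral\<^sup>L M \<phi> = (LINT x:Y \<union> - Y|M. \<phi> x)"
        by (simp add: set_lebesgue_integral_def)
      also have "\<dots> = (LINT x:Y|M. \<phi> x) + (LINT x:- Y|M. \<phi> x)"
      proof (rule set_integral_Un)
        show "set_integrable M Y \<phi>" "set_integrable M (- Y) \<phi>"
          unfolding set_integrable_def
          by (rule integrable_mult_indicator; simp add: that Y)+
      qed simp
      finally show ?thesis .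
    qed
    have "integral\<^sup>L \<mu>' \<phi> = (LINT x:Y|\<mu>. \<phi> x) - (LINT x:Y|\<nu>. \<phi> x)"
      unfolding \<mu>'_def using fin int le by (subst integral_diff_measure) (auto intro!: R_fin R_int simp: R_int)
    moreover have "integral\<^sup>L \<nu>' \<phi> = (LINT x:- Y|\<nu>. \<phi> x) - (LINT x:- Y|\<mu>. \<phi> x)"
      unfolding \<nu>'_def using fin int le by (subst integral_diff_measure) (auto intro!: R_fin R_int simp: R_int)
    ultimately show "(LINT x|lebesgue. u x * deriv \<phi> x) = - ((LINT x|\<mu>'. \<phi> x) - (LINT x|\<nu>'. \<phi> x))"
      using has_measure_derivative_test[OF assms \<phi>] split[OF int(1)] split[OF int(2)] by simp
  qed (use fin' in auto)
  ultimately show ?thesis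
    by blast
qed

text \<open>Existence and uniqueness together make the definite description in
  \<open>jordan_derivative\<close> denote the Jordan pair.\<close>

lemma jordan_derivative:
  assumes "u \<in> BV"
  shows "has_measure_derivative u (D_pos u) (D_neg u)" "mutually_singular (D_pos u) (D_neg u)"
proof -
  let ?Q = "\<lambda>p. has_measure_derivative u (fst p) (snd p) \<and> mutually_singular (fst p) (snd p)"
  have "\<exists>!p. ?Q p"
  proof -
    obtain \<mu> \<nu> where *: "has_measure_derivative u \<mu> \<nu>" "mutually_singular \<mu> \<nu>"
      using assms jordan_pair_exists unfolding BV_def by blast
    show ?thesis
    proof
      show "?Q (\<mu>, \<nu>)" using * by simp
      show "p = (\<mu>, \<nu>)" if "?Q p" for p
        using jordan_pair_unique[OF _ _ *] that by (cases p) auto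
    qed
  qed
  from theI'[OF this] show "has_measure_derivative u (D_pos u) (D_neg u)"
    "mutually_singular (D_pos u) (D_neg u)"
    by (auto simp: D_pos_def D_neg_def jordan_derivative_def)
qed

text \<open>Cutoffs supported in \<open>S\<close> see only zeros of \<open>u\<close>, so the two
  parts agree on all Borel subsets of \<open>S\<close>. Mutually singular measures that agree on
  \<open>S\<close> both vanish there.\<close>

lemma jordan_derivative_null_open_interval:
  assumes BV: "u \<in> BV" and "S = {..<c} \<or> S = {c<..}" and S: "AE x in lebesgue. x \<in> S \<longrightarrow> u x = 0"
  shows "emeasure (D_pos u) S = 0 \<and> emeasure (D_neg u) S = 0"
proof -
  define \<mu> \<nu> where "\<mu> = D_pos u" and "\<nu> = D_neg u"
  have der: "has_measure_derivative u \<mu> \<nu>" and sing: "mutually_singular \<mu> \<nu>"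
    using jordan_derivative[OF BV] by (simp_all add: \<mu>_def \<nu>_def)
  then have fin: "finite_measure \<mu>" "finite_measure \<nu>"
    and sets: "sets \<mu> = sets borel" "sets \<nu> = sets borel"
    by (simp_all add: has_measure_derivative_def)
  have Sb: "S \<in> sets borel" and "open S"
    using assms(2) by auto
  have int: "measure \<mu> {a<..<b} = measure \<nu> {a<..<b}" if "{a<..<b} \<subseteq> S" for a b
  proof -
    have "(LINT x|lebesgue. u x * deriv (cutoff a b k) x) = 0" if "k \<ge> 0" for k
    proof -
      \<comment> \<open>Away from \<open>[a, b]\<close> the cutoff is locally 0 and so is its
        derivative. The endpoints escape this local argument and are discarded as a null
        set.\<close>
      have "AE x in lebesgue. x \<notin> {a, b}"
        by (intro AE_not_in null_sets_completionI finite_imp_null_set_lborel) simp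
      with S have "AE x in lebesgue. u x * deriv (cutoff a b k) x = 0"
      proof eventually_elim
        case (elim x)
        show ?case
        proof (cases "x \<in> S")
          case False
          then have "x \<in> - {a..b}"
            using elim \<open>{a<..<b} \<subseteq> S\<close> by force
          have "((\<lambda>_. 0) has_real_derivative 0) (at x)" by simp
          then have "(cutoff a b k has_real_derivative 0) (at x)"
            by (rule has_field_derivative_transform_within_open[where S = "- {a..b}"])
              (use \<open>x \<in> - {a..b}\<close> \<open>k \<ge> 0\<close> in \<open>auto simp: cutoff_eq_0\<close>)
          then show ?thesis
            by (simp add: DERIV_imp_deriv)
        qed (use elim in simp)
      qed
      then show ?thesis
        by (rule integral_eq_zero_AE)
    qed
    then have "(\<lambda>n. (LINT x|\<mu>. cutoff a b (real n) x) - (LINT x|\<nu>. cutoff a b (real n) x)) = (\<lambda>_. 0)"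
      by (simp add: has_measure_derivative_test[OF der] test_function_cutoff)
    then have "measure \<mu> {a<..<b} - measure \<nu> {a<..<b} = 0"
      using measure_cutoff_tendsto[OF der, of a b] by (simp add: LIMSEQ_const_iff)
    then show ?thesis
      by simp
  qed
  have eq: "measure \<mu> (B \<inter> S) = measure \<nu> (B \<inter> S)" if "B \<in> sets borel" for B
  proof -
    have "measure \<mu> ({a<..<b} \<inter> S) = measure \<nu> ({a<..<b} \<inter> S)" for a b
    proof -
      have "{a<..<b} \<inter> S = {a<..<min b c} \<or> {a<..<b} \<inter> S = {max a c<..<b}"
        using assms(2) by auto
      then show ?thesis
        using int by (metis inf_le2)
    qed
    \<comment> \<open>Comparing with a pair of zero measures expresses that the signed measure
      vanishes on \<open>S\<close>.\<close>
    then show ?thesis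
      using signed_measure_eqI[of \<mu> \<nu> "null_measure borel" "null_measure borel" S B]
        fin sets Sb that by (simp add: finite_measureI)
  qed
  obtain N where N: "N \<in> sets borel" "emeasure \<mu> N = 0" "emeasure \<nu> (UNIV - N) = 0"
    using sing by (auto simp: mutually_singular_def sets sets_eq_imp_space_eq[OF sets(2)])
  have \<mu>N: "emeasure \<mu> (N \<inter> S) = 0" and \<nu>N: "emeasure \<nu> ((UNIV - N) \<inter> S) = 0"
    using N sets Sb emeasure_mono[of "N \<inter> S" N \<mu>] emeasure_mono[of "(UNIV - N) \<inter> S" "UNIV - N" \<nu>]
    by auto
  \<comment> \<open>Off \<open>N\<close> the measure \<open>\<nu>\<close> vanishes on
    \<open>S\<close>, hence so does \<open>\<mu>\<close>; on \<open>N\<close> the roles are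
    exchanged.\<close>
  have "emeasure \<mu> ((UNIV - N) \<inter> S) = 0" "emeasure \<nu> (N \<inter> S) = 0"
    using eq[of "UNIV - N"] eq[of N] \<mu>N \<nu>N N(1) fin
    by (simp_all add: finite_measure.emeasure_eq_measure)
  moreover have "S = (N \<inter> S) \<union> ((UNIV - N) \<inter> S)"
    by auto
  ultimately show ?thesis
    using \<mu>N \<nu>N N(1) Sb sets unfolding \<mu>_def[symmetric] \<nu>_def[symmetric]
    by (metis emeasure_Un_null_set null_setsI sets.Int sets.Diff sets.compl_sets sets_eq_imp_space_eq space_borel)
qed

lemma jordan_derivative_carried:
  assumes "u \<in> BV" and "AE x in lebesgue. x \<notin> {a..b} \<longrightarrow> u x = 0"
  shows "AE x in D_pos u. x \<in> {a..b}" "AE x in D_neg u. x \<in> {a..b}"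
proof -
  have "emeasure (D_pos u) {..<a} = 0 \<and> emeasure (D_neg u) {..<a} = 0"
    using assms by (intro jordan_derivative_null_open_interval) auto
  moreover have "emeasure (D_pos u) {b<..} = 0 \<and> emeasure (D_neg u) {b<..} = 0"
    using assms by (intro jordan_derivative_null_open_interval) auto
  moreover have "sets (D_pos u) = sets borel" "sets (D_neg u) = sets borel"
    using jordan_derivative(1)[OF assms(1)] by (simp_all add: has_measure_derivative_def)
  ultimately have null: "{..<a} \<in> null_sets M \<and> {b<..} \<in> null_sets M" if "M = D_pos u \<or> M = D_neg u" for M
    using that by (elim disjE) (simp_all add: null_sets_def)
  have "AE x in M. x \<in> {a..b}" if "M = D_pos u \<or> M = D_neg u" for M
    using AE_not_in[OF conjunct1[OF null[OF that]]] AE_not_in[OF conjunct2[OF null[OF that]]]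
    by eventually_elim simp
  then show "AE x in D_pos u. x \<in> {a..b}" "AE x in D_neg u. x \<in> {a..b}"
    by blast+
qed

section \<open>Integrals over the carrier and the normalisation of \<open>A\<close> against the
  derivative\<close>

lemma set_integral_nonneg:
  fixes f :: "'a \<Rightarrow> real"
  assumes "\<And>x. x \<in> S \<Longrightarrow> 0 \<le> f x"
  shows "0 \<le> (LINT x:S|M. f x)"
  unfolding set_lebesgue_integral_def using assms
  by (intro integral_nonneg_AE AE_I2) (simp add: indicator_def)

lemma set_integral_eq_integral_AE:
  assumes "AE x in M. x \<in> S" "f \<in> borel_measurable M" "S \<in> sets M"
  shows "(LINT x:S|M. f x) = (LINT x|M. f x :: real)"
  unfolding set_lebesgue_integral_def
  using assms by (intro integral_cong_AE) (auto elim!: eventually_mono)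

lemma integral_A_diff:
  assumes u: "u \<in> A_BV R1 R2"
  shows "(LINT r:{R1..R2}|D_pos u. A R2 r) - (LINT r:{R1..R2}|D_neg u. A R2 r) = 1"
proof -
  \<comment> \<open>With slope 1 and margin 2 the cutoff equals 1 on
    \<open>[R1 - 1, R2 + 1]\<close>. Thus \<open>\<phi>\<close> agrees with \<open>A\<close> on an
    open neighbourhood of \<open>[R1, R2]\<close>, which yields the derivative at the endpoints as
    well.\<close>
  define \<eta> where "\<eta> = cutoff (R1 - 2) (R2 + 2) 1"
  define \<phi> where "\<phi> x = A R2 x * \<eta> x" for x
  have BV: "u \<in> BV" and supp: "AE r in lebesgue. r \<notin> {R1..R2} \<longrightarrow> u r = 0"
    and norm: "(LINT r:{R1..R2}|lebesgue. r\<^sup>2 * u r) = 1"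
    using u by (auto simp: A_BV_def)
  have um: "u \<in> borel_measurable lebesgue"
    using BV by (auto simp: BV_def)
  note der = jordan_derivative(1)[OF BV]
  have "diff_upto n (A R2)" for n
  proof -
    have "diff_upto n (\<lambda>r. R2 ^ 3 / 3 + (- 1 / 3) * r ^ 3)"
      by (intro diff_upto_add diff_upto_mult diff_upto_const diff_upto_power)
    then show ?thesis
      by (simp add: A_def[abs_def] diff_divide_distrib)
  qed
  then have test: "test_function \<phi>"
    unfolding \<phi>_def[abs_def] \<eta>_def by (rule test_function_mult_cutoff) simp
  have \<phi>_eq: "\<phi> x = A R2 x" if "x \<in> {R1 - 1<..<R2 + 1}" for x
    using that by (simp add: \<phi>_def \<eta>_def cutoff_eq_1)
  have deriv: "deriv \<phi> x = - x\<^sup>2" if "x \<in> {R1..R2}" for x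
  proof -
    have "(A R2 has_real_derivative - x\<^sup>2) (at x)"
      unfolding A_def[abs_def] by (auto intro!: derivative_eq_intros)
    then have "(\<phi> has_real_derivative - x\<^sup>2) (at x)"
      by (rule has_field_derivative_transform_within_open[where S = "{R1 - 1<..<R2 + 1}"])
        (use that in \<open>auto simp: \<phi>_eq\<close>)
    then show ?thesis
      by (rule DERIV_imp_deriv)
  qed
  have "(LINT x|lebesgue. u x * deriv \<phi> x) = (LINT x|lebesgue. - (indicator {R1..R2} x * (x\<^sup>2 * u x)))"
  proof (rule integral_cong_AE)
    have *: "AE x in lebesgue. u x * deriv \<phi> x = - (indicator {R1..R2} x * (x\<^sup>2 * u x))"
      using supp by eventually_elim (auto simp: deriv indicator_def)
    show "(\<lambda>x. - (indicator {R1..R2} x * (x\<^sup>2 * u x))) \<in> borel_measurable lebesgue"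
      using um by (intro borel_measurable_uminus borel_measurable_times)
        (auto intro: measurable_completion simp: borel_measurable_indicator_iff)
    have "deriv \<phi> \<in> borel_measurable lebesgue"
      using test_function_deriv_borel_measurable[OF test] by (intro measurable_completion) simp
    with um show "(\<lambda>x. u x * deriv \<phi> x) \<in> borel_measurable lebesgue"
      by (rule borel_measurable_times)
    show "AE x in lebesgue. u x * deriv \<phi> x = - (indicator {R1..R2} x * (x\<^sup>2 * u x))"
      by fact
  qed
  also have "\<dots> = - 1"
    using norm by (simp add: set_lebesgue_integral_def)
  finally have "(LINT x|D_pos u. \<phi> x) - (LINT x|D_neg u. \<phi> x) = 1"
    using has_measure_derivative_test[OF der test] by simp
  \<comment> \<open>A measure carried by \<open>[R1, R2]\<close> does not see the region where the
    cutoff alters \<open>A\<close>.\<close>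
  moreover have "(LINT r:{R1..R2}|M. A R2 r) = (LINT x|M. \<phi> x)"
    if "AE x in M. x \<in> {R1..R2}" "sets M = sets borel" for M
  proof -
    have "(LINT r:{R1..R2}|M. A R2 r) = (LINT r:{R1..R2}|M. \<phi> r)"
      using that by (intro set_lebesgue_integral_cong) (auto simp: \<phi>_eq)
    also have "\<dots> = (LINT x|M. \<phi> x)"
      using that test_function_borel_measurable[OF test]
      by (intro set_integral_eq_integral_AE) (auto simp: measurable_cong_sets[OF that(2) refl])
    finally show ?thesis .
  qed
  ultimately show ?thesis
    using jordan_derivative_carried[OF BV supp] der by (simp add: has_measure_derivative_def)
qed

section \<open>The minimum of \<open>\<Psi>\<close>\<close>

context
  fixes M1 R2 :: real
  assumes M1: "0 < M1" and R2: "2 * M1 < R2"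
begin

text \<open>Both nonconstant terms increase strictly because \<open>M1\<close> and \<open>R2\<close>
  are positive; the cube root supplies monotonicity of the cube for all signs.\<close>

lemma cubic_strict_mono:
  "x < y \<Longrightarrow> M1 * x ^ 3 + 3 * R2 ^ 3 * x - 7 * M1 * R2 ^ 3
    < M1 * y ^ 3 + 3 * R2 ^ 3 * y - 7 * M1 * R2 ^ 3"
  using M1 R2 real_root_less_iff[of 3 "x ^ 3" "y ^ 3"]
  by (intro diff_strict_right_mono add_strict_mono mult_strict_left_mono)
    (auto simp: odd_real_root_power_cancel)

text \<open>The cubic is negative at 0 and equals \<open>3 R2^3 (R2 - 2 M1) > 0\<close> at
  \<open>R2\<close>. The intermediate value theorem and strict monotonicity give exactly one real
  root, lying left of the zero \<open>R2\<close> of \<open>A\<close>.\<close>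

lemma x0_root: "M1 * x0 M1 R2 ^ 3 + 3 * R2 ^ 3 * x0 M1 R2 - 7 * M1 * R2 ^ 3 = 0"
  and x0_less: "x0 M1 R2 < R2"
proof -
  let ?p = "\<lambda>x. M1 * x ^ 3 + 3 * R2 ^ 3 * x - 7 * M1 * R2 ^ 3"
  have "R2 ^ 3 > 0"
    using M1 R2 by simp
  have p_R2: "?p R2 > 0"
  proof -
    have "?p R2 = 3 * R2 ^ 3 * (R2 - 2 * M1)"
      by (simp add: algebra_simps power_numeral_reduce)
    then show ?thesis
      using \<open>R2 ^ 3 > 0\<close> R2 by simp
  qed
  have "\<exists>x\<ge>0. x \<le> R2 \<and> ?p x = 0"
    using M1 R2 p_R2 \<open>R2 ^ 3 > 0\<close>
    by (intro IVT') (auto intro!: continuous_intros)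
  then have "\<exists>!x. ?p x = 0"
    using cubic_strict_mono by (metis linorder_neqE_linordered_idom order_less_irrefl)
  then show root: "?p (x0 M1 R2) = 0"
    unfolding x0_def by (rule theI')
  show "x0 M1 R2 < R2"
    using cubic_strict_mono[of R2 "x0 M1 R2"] root p_R2 by (metis linorder_neqE_linordered_idom order_less_asym)
qed

text \<open>This is the logarithm of \<open>\<Psi> / 3\<close>; it turns monotonicity into the sign
  of a rational function.\<close>

definition "log_Psi r = 7 / 2 * ln r - 1 / 2 * ln (r - 2 * M1) - ln (R2 ^ 3 - r ^ 3)"

lemma Psi_eq_exp:
  assumes "2 * M1 < r" "r < R2"
  shows "Psi M1 R2 r = 3 * exp (log_Psi r)"
proof -
  have "R2 ^ 3 - r ^ 3 > 0"
    using assms M1 by (simp add: power_strict_mono)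
  moreover have "sqrt (r - 2 * M1) = exp (1 / 2 * ln (r - 2 * M1))"
    using assms by (simp add: powr_half_sqrt[symmetric] powr_def)
  ultimately show ?thesis
    using assms M1
    by (simp add: Psi_def q_def A_def log_Psi_def exp_diff powr_def)
qed

lemma DERIV_log_Psi:
  assumes "2 * M1 < r" "r < R2"
  shows "(log_Psi has_real_derivative
    (M1 * r ^ 3 + 3 * R2 ^ 3 * r - 7 * M1 * R2 ^ 3) / (r * (r - 2 * M1) * (R2 ^ 3 - r ^ 3))) (at r)"
proof -
  have pos: "R2 ^ 3 - r ^ 3 > 0" "r > 0" "r - 2 * M1 > 0"
    using assms M1 by (simp_all add: power_strict_mono)
  have "(log_Psi has_real_derivative
      7 / 2 * (1 / r) - 1 / 2 * (1 / (r - 2 * M1)) - (- (3 * r\<^sup>2)) / (R2 ^ 3 - r ^ 3)) (at r)"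
    unfolding log_Psi_def[abs_def] using pos
    by (intro DERIV_diff DERIV_cmult) (auto intro!: derivative_eq_intros)
  moreover have "7 / 2 * (1 / r) - 1 / 2 * (1 / (r - 2 * M1)) - (- (3 * r\<^sup>2)) / (R2 ^ 3 - r ^ 3)
      = (M1 * r ^ 3 + 3 * R2 ^ 3 * r - 7 * M1 * R2 ^ 3) / (r * (r - 2 * M1) * (R2 ^ 3 - r ^ 3))"
  proof -
    \<comment> \<open>Treating \<open>r - 2 M1\<close> and \<open>R2^3 - r^3\<close> as atoms
      \<open>s\<close> and \<open>D\<close> keeps the common denominator factored; expanding the
      numerator afterwards gives twice the cubic.\<close>
    have "7 / 2 * (1 / r) - 1 / 2 * (1 / s) - (- (3 * r\<^sup>2)) / D
      = (7 * s * D - r * D + 6 * r\<^sup>2 * r * s) / (2 * (r * s * D))"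
      if "s > 0" "D > 0" for s D
      using pos(2) that by (simp add: field_simps power2_eq_square)
    from this[OF pos(3,1)] show ?thesis
      using pos by (simp add: frac_eq_eq) (simp add: algebra_simps power_numeral_reduce)
  qed
  ultimately show ?thesis
    by simp
qed

text \<open>The derivative of \<open>log_Psi\<close> has a positive denominator, so it is
  nonpositive up to \<open>x0\<close> and nonnegative beyond. Every path from \<open>a\<close> to
  \<open>r\<close> inside \<open>[R1, R2)\<close> is therefore uphill.\<close>

lemma Psi_minimum:
  assumes "2 * M1 < R1" "R1 \<le> r" "r < R2"
  shows "lambda_star M1 R1 R2 \<le> Psi M1 R2 r"
proof -
  define a where "a = max R1 (x0 M1 R2)"
  have a: "2 * M1 < a" "a < R2" "R1 \<le> a"
    using assms x0_less by (auto simp: a_def)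
  have den: "s * (s - 2 * M1) * (R2 ^ 3 - s ^ 3) > 0" if "2 * M1 < s" "s < R2" for s
    using that M1 by (simp add: power_strict_mono)
  have "log_Psi a \<le> log_Psi r"
  proof (cases "a \<le> r")
    case True
    show ?thesis
    proof (rule DERIV_nonneg_imp_nondecreasing[OF True])
      fix s assume s: "a \<le> s" "s \<le> r"
      then have "M1 * s ^ 3 + 3 * R2 ^ 3 * s - 7 * M1 * R2 ^ 3 \<ge> 0"
        using cubic_strict_mono[of "x0 M1 R2" s] x0_root by (cases "s = x0 M1 R2") (auto simp: a_def)
      then show "\<exists>y. DERIV log_Psi s :> y \<and> 0 \<le> y"
        using DERIV_log_Psi[of s] den[of s] s a assms by (intro exI conjI) (auto intro!: divide_nonneg_pos)
    qed
  next
    case False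
    \<comment> \<open>Since \<open>R1 \<le> r < a\<close>, the maximum must be attained by
      \<open>x0\<close>.\<close>
    then have "r \<le> a" "a = x0 M1 R2"
      using assms by (auto simp: a_def max_def split: if_splits)
    show ?thesis
    proof (rule DERIV_nonpos_imp_nonincreasing[OF \<open>r \<le> a\<close>])
      fix s assume s: "r \<le> s" "s \<le> a"
      then have "M1 * s ^ 3 + 3 * R2 ^ 3 * s - 7 * M1 * R2 ^ 3 \<le> 0"
        using cubic_strict_mono[of s "x0 M1 R2"] x0_root \<open>a = x0 M1 R2\<close>
        by (cases "s = x0 M1 R2") auto
      then show "\<exists>y. DERIV log_Psi s :> y \<and> y \<le> 0"
        using DERIV_log_Psi[of s] den[of s] s a assms by (intro exI conjI) (auto intro!: divide_nonpos_pos)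
    qed
  qed
  then show ?thesis
    using a assms by (simp add: lambda_star_def a_def[symmetric] Psi_eq_exp)
qed

lemma lambda_star_pos:
  assumes "2 * M1 < R1" "R1 < R2"
  shows "lambda_star M1 R1 R2 > 0"
  using assms x0_less by (simp add: lambda_star_def Psi_eq_exp less_max_iff_disj)

lemma g_nonneg:
  assumes "2 * M1 < R1" "R1 \<le> r" "r \<le> R2"
  shows "g M1 R1 R2 r \<ge> 0"
proof (cases "r < R2")
  case True
  then have "A R2 r > 0"
    using assms M1 by (simp add: A_def power_strict_mono)
  then show ?thesis
    using Psi_minimum[OF assms(1,2) True] by (simp add: g_def Psi_def field_simps)
next
  \<comment> \<open>At \<open>r = R2\<close> the quotient \<open>\<Psi>\<close> is meaningless, but
    \<open>A\<close> vanishes and \<open>g\<close> reduces to \<open>q\<close>.\<close>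
  case False
  then show ?thesis
    using assms by (simp add: g_def q_def A_def)
qed

end

section \<open>The deficit identity\<close>

text \<open>The integrand is nonnegative almost everywhere and has total integral 1, so
  \<open>P\<close> increases within \<open>[0, 1]\<close>. Monotonicity also yields Borel
  measurability.\<close>

lemma P_bounds:
  assumes u: "u \<in> A_BV R1 R2"
  shows "0 \<le> P R1 u r" "P R1 u r \<le> 1" "P R1 u \<in> borel_measurable borel"
proof -
  have BV: "u \<in> BV" and nonneg: "AE r in lebesgue. 0 \<le> u r"
    and supp: "AE r in lebesgue. r \<notin> {R1..R2} \<longrightarrow> u r = 0"
    and norm: "(LINT r:{R1..R2}|lebesgue. r\<^sup>2 * u r) = 1"
    using u by (auto simp: A_BV_def)
  \<comment> \<open>Truncation to \<open>[R1, R2]\<close> changes the integrand only on a null set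
    and lets \<open>r\<close> range over the whole line.\<close>
  define h where "h s = indicator {R1..R2} s * (s\<^sup>2 * u s)" for s
  have um: "integrable lebesgue u"
    using BV by (auto simp: BV_def)
  have h_eq: "AE s in lebesgue. s\<^sup>2 * u s = h s"
    using supp by eventually_elim (auto simp: h_def)
  \<comment> \<open>A non-integrable function has integral 0 by default, while the normalisation is
    1; hence \<open>h\<close> is integrable.\<close>
  have h_int: "integrable lebesgue h"
    using norm not_integrable_integral_eq[of lebesgue h]
    by (auto simp: h_def[abs_def] set_lebesgue_integral_def)
  have h_nonneg: "AE s in lebesgue. 0 \<le> h s"
    using nonneg by eventually_elim (simp add: h_def)
  have meas: "(\<lambda>s. s\<^sup>2 * u s) \<in> borel_measurable lebesgue"
    using um by (intro borel_measurable_times) (auto intro: measurable_completion)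
  have P_eq: "P R1 u r = (LINT s:{R1..r}|lebesgue. h s)" for r
    unfolding P_def set_lebesgue_integral_def
    using h_eq borel_measurable_integrable[OF h_int] meas
    by (intro integral_cong_AE borel_measurable_scaleR borel_measurable_indicator)
      (auto elim!: eventually_mono)
  have set_int: "integrable lebesgue (\<lambda>s. indicator {R1..r} s *\<^sub>R h s)" for r
    using h_int by (intro integrable_mult_indicator) auto
  have mono: "mono (P R1 u)"
  proof (rule monoI)
    fix r r' :: real assume "r \<le> r'"
    show "P R1 u r \<le> P R1 u r'"
      unfolding P_eq set_lebesgue_integral_def
    proof (rule integral_mono_AE[OF set_int set_int])
      show "AE s in lebesgue. indicator {R1..r} s *\<^sub>R h s \<le> indicator {R1..r'} s *\<^sub>R h s"
        using h_nonneg by eventually_elim (use \<open>r \<le> r'\<close> in \<open>auto simp: indicator_def\<close>)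
    qed
  qed
  show "P R1 u \<in> borel_measurable borel"
    using mono by (rule borel_measurable_mono)
  show "0 \<le> P R1 u r"
    unfolding P_eq set_lebesgue_integral_def
    by (rule integral_nonneg_AE) (use h_nonneg in \<open>auto elim!: eventually_mono\<close>)
  have "P R1 u r \<le> (LINT s|lebesgue. h s)"
    unfolding P_eq set_lebesgue_integral_def
  proof (rule integral_mono_AE[OF set_int h_int])
    show "AE s in lebesgue. indicator {R1..r} s *\<^sub>R h s \<le> h s"
      using h_nonneg by eventually_elim (auto simp: indicator_def)
  qed
  also have "\<dots> = 1"
    using norm by (simp add: h_def[abs_def] set_lebesgue_integral_def)
  finally show "P R1 u r \<le> 1" .
qed

text \<open>This exhibits \<open>q\<close> as \<open>W\<close> with \<open>P = 0\<close>, so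
  comparing the two reduces to comparing \<open>F\<close> with \<open>1 - 2 M1 / r\<close>.\<close>

lemma q_eq:
  assumes "0 < M1" "2 * M1 < r"
  shows "q M1 r = r ^ 3 / sqrt (1 - 2 * M1 / r)"
proof -
  have "r powr (7 / 2) = r powr (3 + 1 / 2)"
    by simp
  also have "\<dots> = r ^ 3 * sqrt r"
    using assms by (simp only: powr_add powr_half_sqrt) simp
  finally have "r powr (7 / 2) = r ^ 3 * sqrt r" .
  moreover have "1 - 2 * M1 / r = (r - 2 * M1) / r"
    using assms by (simp add: field_simps)
  ultimately show ?thesis
    using assms by (simp add: q_def real_sqrt_divide)
qed

theorem proposition4p1:
  fixes M1 M2 R1 R2 :: real and u :: "real \<Rightarrow> real" and \<mu> \<nu> :: "real measure"
  assumes "0 < M1" and "M1 < M2" and "2 * M2 < R1" and "R1 < R2"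
    and "u \<in> A_BV R1 R2"
    and "\<mu> = D_pos u" and "\<nu> = D_neg u"
  shows "deficit M1 M2 R1 R2 u =
           (LINT r:{R1..R2}|\<mu>. W M1 M2 R1 u r - q M1 r)
         + (LINT r:{R1..R2}|\<mu>. g M1 R1 R2 r)
         + lambda_star M1 R1 R2 * (LINT r:{R1..R2}|\<nu>. A R2 r)
         \<and> 0 \<le> (LINT r:{R1..R2}|\<mu>. W M1 M2 R1 u r - q M1 r)
         \<and> 0 \<le> (LINT r:{R1..R2}|\<mu>. g M1 R1 R2 r)
         \<and> 0 \<le> lambda_star M1 R1 R2 * (LINT r:{R1..R2}|\<nu>. A R2 r)"
proof -
  note M = assms(1-4)
  define lam where "lam = lambda_star M1 R1 R2"
  \<comment> \<open>A uniform bound for \<open>W\<close>: the numerator is largest at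
    \<open>R2\<close>, and \<open>F\<close> is at least \<open>1 - 2 M2 / R1\<close>, which is
    positive because \<open>R1 > 2 M2\<close>.\<close>
  define C where "C = R2 ^ 3 / sqrt (1 - 2 * M2 / R1)"
  have BV: "u \<in> BV"
    using assms(5) by (simp add: A_BV_def)
  have fin: "finite_measure \<mu>" and sets: "sets \<mu> = sets borel"
    using jordan_derivative(1)[OF BV] assms(6) by (simp_all add: has_measure_derivative_def)
  have q_le_W: "q M1 r \<le> W M1 M2 R1 u r" and W_le: "W M1 M2 R1 u r \<le> C" and q_nonneg: "0 \<le> q M1 r"
    if r: "r \<in> {R1..R2}" for r
  proof -
    have r_pos: "r > 0"
      using M r by auto
    have "1 - 2 * M2 / R1 \<le> 1 - 2 * M2 / r"
      using M r by (simp add: frac_le)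
    also have "\<dots> \<le> F M1 M2 R1 u r"
    proof -
      \<comment> \<open>From \<open>P \<le> 1\<close> the enclosed mass
        \<open>M1 + (M2 - M1) P\<close> is at most \<open>M2\<close>.\<close>
      have "(M2 - M1) * P R1 u r \<le> M2 - M1"
        using M by (intro mult_left_le P_bounds(2)[OF assms(5)]) simp
      then show ?thesis
        using r_pos by (simp add: F_def divide_right_mono)
    qed
    finally have 1: "1 - 2 * M2 / R1 \<le> F M1 M2 R1 u r" .
    have 2: "F M1 M2 R1 u r \<le> 1 - 2 * M1 / r"
      using r_pos M P_bounds(1)[OF assms(5), of r] by (simp add: F_def divide_right_mono)
    have 3: "0 < 1 - 2 * M2 / R1"
      using M by simp
    have 4: "0 < F M1 M2 R1 u r"
      using 1 3 by linarith
    show "q M1 r \<le> W M1 M2 R1 u r"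
      using 2 4 r_pos M r by (simp add: q_eq W_def) (intro divide_left_mono mult_pos_pos; simp)
    show "W M1 M2 R1 u r \<le> C"
      unfolding W_def C_def using 1 2 3 r_pos M r by (intro frac_le power_mono) auto
    show "0 \<le> q M1 r"
      using M r by (simp add: q_def)
  qed
  \<comment> \<open>The measure is finite, so a Borel function bounded on the interval is
    integrable; this licenses the splitting of integrals below.\<close>
  have set_int: "set_integrable \<mu> {R1..R2} f"
    if "f \<in> borel_measurable borel" "\<And>r. r \<in> {R1..R2} \<Longrightarrow> \<bar>f r\<bar> \<le> c" for f :: "real \<Rightarrow> real" and c
    unfolding set_integrable_def
  proof (rule finite_measure.integrable_const_bound[OF fin])
    show "AE r in \<mu>. norm (indicator {R1..R2} r *\<^sub>R f r) \<le> \<bar>c\<bar>"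
      using that(2) by (intro AE_I2) (force simp: indicator_def)
    show "(\<lambda>r. indicator {R1..R2} r *\<^sub>R f r) \<in> borel_measurable \<mu>"
      using that(1) by (simp add: measurable_cong_sets[OF sets refl])
  qed
  have int_q: "set_integrable \<mu> {R1..R2} (q M1)"
  proof (rule set_int)
    show "q M1 \<in> borel_measurable borel"
      unfolding q_def[abs_def] by measurable
    show "\<bar>q M1 r\<bar> \<le> C" if "r \<in> {R1..R2}" for r
      using q_nonneg[OF that] q_le_W[OF that] W_le[OF that] by simp
  qed
  have int_W: "set_integrable \<mu> {R1..R2} (W M1 M2 R1 u)"
  proof (rule set_int)
    note [measurable] = P_bounds(3)[OF assms(5)]
    show "W M1 M2 R1 u \<in> borel_measurable borel"
      unfolding W_def[abs_def] F_def[abs_def] by measurable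
    show "\<bar>W M1 M2 R1 u r\<bar> \<le> C" if "r \<in> {R1..R2}" for r
      using q_nonneg[OF that] q_le_W[OF that] W_le[OF that] by simp
  qed
  have A_bounds: "0 \<le> A R2 r \<and> A R2 r \<le> R2 ^ 3" if "r \<in> {R1..R2}" for r
  proof -
    have "0 \<le> r ^ 3" "r ^ 3 \<le> R2 ^ 3"
      using M that by (auto intro: power_mono)
    moreover have "0 \<le> (c - b) / 3 \<and> (c - b) / 3 \<le> c" if "0 \<le> b" "b \<le> c" for b c :: real
      using that by (simp add: field_simps)
    ultimately show ?thesis
      unfolding A_def by blast
  qed
  have int_A: "set_integrable \<mu> {R1..R2} (A R2)"
  proof (rule set_int)
    show "A R2 \<in> borel_measurable borel"
      unfolding A_def[abs_def] by measurable
    show "\<bar>A R2 r\<bar> \<le> R2 ^ 3" if "r \<in> {R1..R2}" for r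
      using A_bounds[OF that] by simp
  qed
  have W_q: "(LINT r:{R1..R2}|\<mu>. W M1 M2 R1 u r - q M1 r)
      = (LINT r:{R1..R2}|\<mu>. W M1 M2 R1 u r) - (LINT r:{R1..R2}|\<mu>. q M1 r)"
    using int_W int_q by (rule set_integral_diff)
  have g: "(LINT r:{R1..R2}|\<mu>. g M1 R1 R2 r)
      = (LINT r:{R1..R2}|\<mu>. q M1 r) - lam * (LINT r:{R1..R2}|\<mu>. A R2 r)"
    using int_q int_A by (simp add: g_def lam_def set_integral_diff)
  have "(LINT r:{R1..R2}|\<mu>. A R2 r) = 1 + (LINT r:{R1..R2}|\<nu>. A R2 r)"
    using integral_A_diff[OF assms(5)] by (simp add: assms(6,7))
  then have "deficit M1 M2 R1 R2 u =
      (LINT r:{R1..R2}|\<mu>. W M1 M2 R1 u r - q M1 r)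
      + (LINT r:{R1..R2}|\<mu>. g M1 R1 R2 r) + lam * (LINT r:{R1..R2}|\<nu>. A R2 r)"
    unfolding W_q g by (simp add: deficit_def J_def lam_def assms(6) algebra_simps)
  moreover have "0 \<le> (LINT r:{R1..R2}|\<mu>. W M1 M2 R1 u r - q M1 r)"
    using q_le_W by (intro set_integral_nonneg) auto
  moreover have "0 \<le> (LINT r:{R1..R2}|\<mu>. g M1 R1 R2 r)"
    using M by (intro set_integral_nonneg g_nonneg) auto
  moreover have "0 \<le> lam"
    unfolding lam_def using M by (intro less_imp_le lambda_star_pos) auto
  moreover have "0 \<le> (LINT r:{R1..R2}|\<nu>. A R2 r)"
    using A_bounds by (intro set_integral_nonneg) auto
  ultimately show ?thesis
    by (simp add: lam_def)
qed

end
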